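(* In the setting described in the context, suppose that $S_0$ is infinite dimensional over $k$, let $\mathcal{C}=\mathbb{R}_{\ge0}\{v_1,\ldots,v_r\}\subseteq N_{\mathbb{R}}$ be the convex cone generated by $v_1,\ldots,v_r$, let $\mathcal{C}^\vee=\{u\in M_{\mathbb{R}}\mid\langle u,v\rangle\ge0\text{ for all }v\in\mathcal{C}\}$ be its dual cone, and let $\{w_1,\ldots,w_h\}\subset M$ be a Hilbert basis of $\mathcal{C}^\vee$. Then $$S_0=k[x^{\omega(w_1)},\ldots,x^{\omega(w_h)}].$$
   Context: $k$ is an algebraically closed field of characteristic $0$, $n=r+s$, $X=k^r\times(k^{\times})^s$, $S=k[x_1,\ldots,x_r,x_{r+1}^{\pm1},\ldots,x_n^{\pm1}]$. $H=(k^\times)^p\times\mathbb{F}$ with $\mathbb{F}$ a product of cyclic groups of orders $d_1,\ldots,d_t$; $m=p+t$; the character group $A=\mathrm{Hom}(H,k^\times)$ is identified with $\mathbb{Z}^p\oplus\mathbb{Z}/d_1\mathbb{Z}\oplus\cdots\oplus\mathbb{Z}/d_t\mathbb{Z}$. $H$ acts diagonally and faithfully on $X$ with weights $\eta_1,\ldots,\eta_n\in A$ ($h$ multiplies the $i$-th coordinate by $\eta_i(h)$), and $L$ is the $m\times n$ integer matrix whose $i$-th column represents $\eta_i$. The degree map is $\deg:\mathbb{Z}^n\to A$, $\deg(\lambda)=L\lambda$ (read in $A$), i.e. $\deg(\lambda)=\sum\lambda_i\eta_i$. $S_0=\mathrm{span}_k\{x^\lambda\in S\mid L\lambda=0\text{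 in }A\}$. Put $l=n-p$. The kernel $\mathfrak{K}$ of $\deg$ is free of rank $l$; fix an $n\times l$ integer matrix $K$ whose columns form a $\mathbb{Z}$-basis of $\mathfrak{K}$, and let $v_1,\ldots,v_r\in N=\mathbb{Z}^l$ be its first $r$ rows. $M=\mathrm{Hom}(N,\mathbb{Z})\cong\mathbb{Z}^l$, with natural pairing $\langle\cdot,\cdot\rangle$; $N_{\mathbb{R}},M_{\mathbb{R}}$ are the scalar extensions to $\mathbb{R}$. $\omega:M\to\mathfrak{K}\subset\mathbb{Z}^n$ is the isomorphism $\omega(u)=Ku$. A Hilbert basis of a rational polyhedral cone is a finite set of integral vectors of the cone such that every integral vector of the cone is a nonnegative integer combination of them. *)

theory Defs
  imports
    "HOL-Library.Poly_Mapping"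
    "HOL-Computational_Algebra.Polynomial"
    "HOL-Algebra.Group_Action"
    "HOL-Algebra.Product_Groups"
    "HOL-Algebra.Elementary_Groups"
    "Jordan_Normal_Form.Matrix"
begin

text \<open>All coordinates are numbered from 0, so the variables that may occur only with nonnegative
  exponents are those with index below r, and the invertible ones have index in r..<n.\<close>

subsection \<open>The Laurent polynomial ring and its subalgebras\<close>

text \<open>Laurent polynomials in countably many variables: an exponent is a finitely supported function
  from variable indices to the integers, and the product is the convolution product of
  \<^theory>\<open>HOL-Library.Poly_Mapping\<close>. The rings in finitely many variables are subsets.\<close>

type_synonym 'k laurent = "(nat \<Rightarrow>\<^sub>0 int) \<Rightarrow>\<^sub>0 'k"

definition kscale :: "'k::field \<Rightarrow> 'k laurent \<Rightarrow> 'k laurent" where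
  "kscale c f = Poly_Mapping.single 0 c * f"

global_interpretation laurent: vector_space "kscale :: 'k::field \<Rightarrow> 'k laurent \<Rightarrow> 'k laurent"
proof
  fix a b :: 'k and x y :: "'k laurent"
  show "kscale a (x + y) = kscale a x + kscale a y"
    by (simp add: kscale_def algebra_simps)
  show "kscale (a + b) x = kscale a x + kscale b x"
    by (simp add: kscale_def single_add algebra_simps)
  show "kscale a (kscale b x) = kscale (a * b) x"
    by (simp add: kscale_def mult_single flip: mult.assoc)
  show "kscale 1 x = x"
    by (simp add: kscale_def)
qed

definition laurent_monom :: "int vec \<Rightarrow> 'k::field laurent" where
  "laurent_monom a =
     Poly_Mapping.single (\<Sum>i<dim_vec a. Poly_Mapping.single i (a $ i)) 1"

text \<open>The ring k[x_1, ..., x_r, x_{r+1}^{+-1}, ..., x_n^{+-1}].\<close>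

definition laurent_ring :: "nat \<Rightarrow> nat \<Rightarrow> 'k::field laurent set" where
  "laurent_ring r n =
     {f. \<forall>e\<in>Poly_Mapping.keys f. Poly_Mapping.keys e \<subseteq> {..<n} \<and>
           (\<forall>i<r. 0 \<le> Poly_Mapping.lookup e i)}"

definition is_subalgebra :: "'k::field laurent set \<Rightarrow> bool" where
  "is_subalgebra B \<longleftrightarrow> laurent.subspace B \<and> 1 \<in> B \<and> (\<forall>f\<in>B. \<forall>g\<in>B. f * g \<in> B)"

definition generated_subalgebra :: "'k::field laurent set \<Rightarrow> 'k laurent set" where
  "generated_subalgebra G = is_subalgebra hull G"

definition infinite_dimensional :: "'k::field laurent set \<Rightarrow> bool" where
  "infinite_dimensional V \<longleftrightarrow> \<not> (\<exists>B. finite B \<and> B \<subseteq> V \<and> laurent.span B = V)"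

subsection \<open>Diagonalizable groups, their characters and diagonal actions\<close>

definition mult_group :: "'k::field monoid" where
  "mult_group = \<lparr>carrier = {x. x \<noteq> 0}, monoid.mult = (*), one = 1\<rparr>"

definition character_group :: "'g monoid \<Rightarrow> ('g \<Rightarrow> 'k::field) monoid" where
  "character_group G =
     \<lparr>carrier = hom G mult_group \<inter> extensional (carrier G),
      monoid.mult = (\<lambda>\<chi> \<psi>. \<lambda>g\<in>carrier G. \<chi> g * \<psi> g),
      one = (\<lambda>g\<in>carrier G. 1)\<rparr>"

definition diag_group ::
  "nat \<Rightarrow> nat \<Rightarrow> (nat \<Rightarrow> 'g monoid) \<Rightarrow> ((nat \<Rightarrow> 'k::field) \<times> (nat \<Rightarrow> 'g)) monoid" where
  "diag_group p t F = product_group {..<p} (\<lambda>_. mult_group) \<times>\<times> product_group {..<t} F"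

text \<open>The group A of the weights.\<close>

definition weight_group :: "nat \<Rightarrow> nat \<Rightarrow> (nat \<Rightarrow> nat) \<Rightarrow> ((nat \<Rightarrow> int) \<times> (nat \<Rightarrow> int)) monoid" where
  "weight_group p t d =
     product_group {..<p} (\<lambda>_. integer_group) \<times>\<times>
     product_group {..<t} (\<lambda>j. integer_mod_group (d j))"

definition weight_class ::
  "nat \<Rightarrow> nat \<Rightarrow> (nat \<Rightarrow> nat) \<Rightarrow> int vec \<Rightarrow> (nat \<Rightarrow> int) \<times> (nat \<Rightarrow> int)" where
  "weight_class p t d a = (\<lambda>q\<in>{..<p}. a $ q, \<lambda>j\<in>{..<t}. a $ (p + j) mod int (d j))"

text \<open>The identification of A with the (algebraic) characters of the group. On the torus it is the
  standard one. On the j-th finite factor there is no canonical choice, and \<iota> j is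
  an isomorphism from the integers modulo d j onto the group of characters of that factor.\<close>

definition character_of ::
  "nat \<Rightarrow> nat \<Rightarrow> (nat \<Rightarrow> int \<Rightarrow> 'g \<Rightarrow> 'k::field) \<Rightarrow>
   (nat \<Rightarrow> int) \<times> (nat \<Rightarrow> int) \<Rightarrow> (nat \<Rightarrow> 'k) \<times> (nat \<Rightarrow> 'g) \<Rightarrow> 'k" where
  "character_of p t \<iota> a h =
     (\<Prod>q<p. fst h q powi fst a q) * (\<Prod>j<t. \<iota> j (snd a j) (snd h j))"

definition affine_torus_space :: "nat \<Rightarrow> nat \<Rightarrow> 'k::field vec set" where
  "affine_torus_space r n = {x \<in> carrier_vec n. \<forall>i. r \<le> i \<and> i < n \<longrightarrow> x $ i \<noteq> 0}"

definition diag_action ::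
  "nat \<Rightarrow> nat \<Rightarrow> ('h \<Rightarrow> nat \<Rightarrow> 'k::field) \<Rightarrow> 'h \<Rightarrow> 'k vec \<Rightarrow> 'k vec" where
  "diag_action r n \<chi> h = (\<lambda>x\<in>affine_torus_space r n. vec n (\<lambda>i. \<chi> h i * x $ i))"

subsection \<open>The degree map and the invariant ring\<close>

definition degree_map ::
  "nat \<Rightarrow> nat \<Rightarrow> (nat \<Rightarrow> nat) \<Rightarrow> int mat \<Rightarrow> int vec \<Rightarrow> (nat \<Rightarrow> int) \<times> (nat \<Rightarrow> int)" where
  "degree_map p t d L a = weight_class p t d (L *\<^sub>v a)"

definition degree_kernel ::
  "nat \<Rightarrow> nat \<Rightarrow> nat \<Rightarrow> (nat \<Rightarrow> nat) \<Rightarrow> int mat \<Rightarrow> int vec set" where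
  "degree_kernel n p t d L =
     {a \<in> carrier_vec n. degree_map p t d L a = \<one>\<^bsub>weight_group p t d\<^esub>}"

definition degree_zero_part ::
  "nat \<Rightarrow> nat \<Rightarrow> nat \<Rightarrow> nat \<Rightarrow> (nat \<Rightarrow> nat) \<Rightarrow> int mat \<Rightarrow> 'k::field laurent set" where
  "degree_zero_part r n p t d L =
     laurent.span {laurent_monom a | a.
       (laurent_monom a :: 'k laurent) \<in> laurent_ring r n \<and> a \<in> degree_kernel n p t d L}"

text \<open>The vectors \<^term>\<open>K *\<^sub>v c\<close> are the integer combinations of the columns of K, so existence
  of c says that the columns span Z and uniqueness that they are linearly independent.\<close>

definition columns_form_int_basis :: "int mat \<Rightarrow> int vec set \<Rightarrow> bool" where
  "columns_form_int_basis K Z \<longleftrightarrow>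
     set (cols K) \<subseteq> Z \<and> (\<forall>a\<in>Z. \<exists>!c. c \<in> carrier_vec (dim_col K) \<and> a = K *\<^sub>v c)"

subsection \<open>Cones\<close>

definition cone_generated :: "nat \<Rightarrow> real vec list \<Rightarrow> real vec set" where
  "cone_generated l vs =
     {vec l (\<lambda>j. \<Sum>i<length vs. c i * (vs ! i) $ j) | c :: nat \<Rightarrow> real.
        \<forall>i<length vs. 0 \<le> c i}"

definition dual_cone :: "nat \<Rightarrow> real vec set \<Rightarrow> real vec set" where
  "dual_cone l C = {u \<in> carrier_vec l. \<forall>v\<in>C. 0 \<le> u \<bullet> v}"

text \<open>A Hilbert basis is not required to be minimal, nor the combinations to be unique.\<close>

definition is_hilbert_basis :: "nat \<Rightarrow> real vec set \<Rightarrow> int vec set \<Rightarrow> bool" where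
  "is_hilbert_basis l C W \<longleftrightarrow>
     finite W \<and> W \<subseteq> carrier_vec l \<and> map_vec real_of_int ` W \<subseteq> C \<and>
     (\<forall>u\<in>carrier_vec l. map_vec real_of_int u \<in> C \<longrightarrow>
        (\<exists>c :: int vec \<Rightarrow> nat. u = vec l (\<lambda>j. \<Sum>w\<in>W. int (c w) * w $ j)))"

end

theory Submission
  imports Defs
begin

text \<open>The space of degree-zero Laurent polynomials is spanned by monomials, so the claim is one about
  the monoid of their exponents. Every exponent \<open>a\<close> in the degree kernel is \<open>K c\<close> for an integral
  vector \<open>c\<close>. The entry of \<open>a\<close> at a coordinate \<open>i < r\<close> is the pairing of \<open>c\<close> with the \<open>i\<close>-th row of
  \<open>K\<close>, so the monomial \<open>x^a\<close> lies in the ring exactly if \<open>c\<close> pairs nonnegatively with each of the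
  first \<open>r\<close> rows, that is, if \<open>c\<close> lies in the dual cone (lemmas \<open>laurent_monom_mem_laurent_ring\<close>
  and \<open>mem_dual_cone_generated\<close>). Hence \<open>c \<mapsto> K c\<close> maps the integral points of the dual cone onto
  the exponents in question, and since \<open>a \<mapsto> x^a\<close> turns sums into products, a Hilbert basis of the
  cone yields generators of the algebra.

  Each inclusion follows from a minimality property. The subalgebra generated by the monomials
  \<open>x^(K w)\<close>, for \<open>w\<close> in the Hilbert basis, is a subspace that contains all monomials of degree zero in
  the ring, because it contains \<open>x^(K c)\<close> for each nonnegative integer combination
  \<open>c\<close> of the Hilbert basis; so it contains their span. Conversely that span is a subalgebra, because
  the exponents form a monoid, and it contains the generators.\<close>

section \<open>Subalgebras and monomials\<close>

lemma is_subalgebra_generated: "is_subalgebra (generated_subalgebra G)"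
  unfolding generated_subalgebra_def
proof (rule hull_in)
  fix T :: "'a laurent set set"
  assume "\<forall>B\<in>T. is_subalgebra B"
  then show "is_subalgebra (\<Inter>T)"
    by (auto simp: is_subalgebra_def laurent.subspace_def)
qed

lemma generated_subalgebra_superset: "G \<subseteq> generated_subalgebra G"
  unfolding generated_subalgebra_def by (rule hull_subset)

lemma generated_subalgebra_least:
  "G \<subseteq> B \<Longrightarrow> is_subalgebra B \<Longrightarrow> generated_subalgebra G \<subseteq> B"
  unfolding generated_subalgebra_def by (rule hull_minimal)

text \<open>Multiplication is bilinear, so closure under products needs to be checked only on the spanning
  set: fix one factor in the spanning set, extend to the span in the other, and repeat with the roles
  exchanged.\<close>

lemma is_subalgebra_span:
  fixes G :: "'k::field laurent set"
  assumes one: "1 \<in> G" and mult: "\<And>f g. f \<in> G \<Longrightarrow> g \<in> G \<Longrightarrow> f * g \<in> G"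
  shows "is_subalgebra (laurent.span G)"
proof -
  have scale_left: "kscale c f * g = kscale c (f * g)" for c and f g :: "'k laurent"
    by (simp add: kscale_def mult.assoc)
  have scale_right: "f * kscale c g = kscale c (f * g)" for c and f g :: "'k laurent"
    by (simp add: kscale_def mult.left_commute)
  have gen: "f * g \<in> laurent.span G" if "f \<in> G" "g \<in> laurent.span G" for f g
    using that(2)
  proof (induction rule: laurent.span_induct_alt)
    case base
    then show ?case by (simp add: laurent.span_zero)
  next
    case (step c x y)
    then show ?case
      using that(1) mult
      by (simp add: distrib_left scale_right laurent.span_add laurent.span_scale laurent.span_base)
  qed
  have "f * g \<in> laurent.span G" if "f \<in> laurent.span G" "g \<in> laurent.span G" for f g
    using that(1)
  proof (induction rule: laurent.span_induct_alt)
    case base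
    then show ?case by (simp add: laurent.span_zero)
  next
    case (step c x y)
    then show ?case
      using that(2) gen
      by (simp add: distrib_right scale_left laurent.span_add laurent.span_scale)
  qed
  then show ?thesis
    using one by (simp add: is_subalgebra_def laurent.span_base)
qed

lemma laurent_monom_zero: "laurent_monom (0\<^sub>v n) = 1"
  by (simp add: laurent_monom_def)

lemma laurent_monom_add:
  assumes "a \<in> carrier_vec n" "b \<in> carrier_vec n"
  shows "laurent_monom (a + b) = laurent_monom a * laurent_monom b"
  using assms by (simp add: laurent_monom_def mult_single single_add sum.distrib)

lemma laurent_monom_mem_laurent_ring:
  assumes "a \<in> carrier_vec n" "r \<le> n"
  shows "(laurent_monom a :: 'k::field laurent) \<in> laurent_ring r n \<longleftrightarrow> (\<forall>i<r. 0 \<le> a $ i)"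
proof -
  define e where "e = (\<Sum>i<n. Poly_Mapping.single i (a $ i))"
  have lookup_e: "Poly_Mapping.lookup e j = (if j < n then a $ j else 0)" for j
    by (simp add: e_def lookup_sum lookup_single when_def)
  have "Poly_Mapping.keys e \<subseteq> {..<n}"
    by (auto simp: in_keys_iff lookup_e split: if_splits)
  moreover have "Poly_Mapping.keys (laurent_monom a :: 'k laurent) = {e}"
    using assms by (simp add: laurent_monom_def e_def)
  ultimately show ?thesis
    using assms(2) by (auto simp: laurent_ring_def lookup_e)
qed

section \<open>Exponents of degree zero\<close>

text \<open>A free factor of the weight group counts as one of modulus 0. In this form both kinds of entries
  are covered by the fact that divisibility passes to integer linear combinations.\<close>

lemma mem_degree_kernel:
  "a \<in> degree_kernel n p t d L \<longleftrightarrow> a \<in> carrier_vec n \<and> (\<forall>q<p. 0 dvd (L *\<^sub>v a) $ q) \<and>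
     (\<forall>j<t. int (d j) dvd (L *\<^sub>v a) $ (p + j))"
  by (auto simp: degree_kernel_def degree_map_def weight_class_def weight_group_def
      product_group_def restrict_def fun_eq_iff dvd_eq_mod_eq_0)

lemma zero_mem_degree_kernel:
  assumes "L \<in> carrier_mat (p + t) n"
  shows "0\<^sub>v n \<in> degree_kernel n p t d L"
  using assms by (simp add: mem_degree_kernel scalar_prod_def)

lemma add_mem_degree_kernel:
  assumes "L \<in> carrier_mat (p + t) n"
    and "a \<in> degree_kernel n p t d L" "b \<in> degree_kernel n p t d L"
  shows "a + b \<in> degree_kernel n p t d L"
  using assms by (auto simp: mem_degree_kernel mult_add_distrib_mat_vec[OF assms(1)])

text \<open>By associativity, \<open>L (K c)\<close> is the combination with coefficients \<open>c\<close> of the images under \<open>L\<close> of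
  the columns of \<open>K\<close>.\<close>

lemma mult_mat_vec_mem_degree_kernel:
  assumes L: "L \<in> carrier_mat (p + t) n" and K: "K \<in> carrier_mat n l"
    and cols: "set (cols K) \<subseteq> degree_kernel n p t d L" and c: "c \<in> carrier_vec l"
  shows "K *\<^sub>v c \<in> degree_kernel n p t d L"
proof -
  have col: "col K i \<in> degree_kernel n p t d L" if "i < l" for i
    using that cols K by (auto simp: cols_def)
  have entry: "(L *\<^sub>v (K *\<^sub>v c)) $ q = (\<Sum>i<l. (L *\<^sub>v col K i) $ q * c $ i)" if "q < p + t" for q
  proof -
    have "(L *\<^sub>v (K *\<^sub>v c)) $ q = (L * K *\<^sub>v c) $ q"
      using L K c by simp
    also have "\<dots> = (\<Sum>i<l. (L *\<^sub>v col K i) $ q * c $ i)"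
      using L K c that by (simp add: scalar_prod_def lessThan_atLeast0 del: assoc_mult_mat_vec)
    finally show ?thesis .
  qed
  show ?thesis
    unfolding mem_degree_kernel
  proof (intro conjI allI impI)
    show "K *\<^sub>v c \<in> carrier_vec n" using K c by simp
    show "0 dvd (L *\<^sub>v (K *\<^sub>v c)) $ q" if "q < p" for q
      unfolding entry[OF trans_less_add1[OF that]]
      using col that by (intro dvd_sum dvd_mult2) (auto simp: mem_degree_kernel)
    show "int (d j) dvd (L *\<^sub>v (K *\<^sub>v c)) $ (p + j)" if "j < t" for j
      unfolding entry[OF add_strict_left_mono[OF that]]
      using col that by (intro dvd_sum dvd_mult2) (auto simp: mem_degree_kernel)
  qed
qed

section \<open>Cones and nonnegative integer combinations\<close>

lemma mem_dual_cone_generated: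
  assumes vs: "set vs \<subseteq> carrier_vec l"
  shows "u \<in> dual_cone l (cone_generated l vs) \<longleftrightarrow>
    u \<in> carrier_vec l \<and> (\<forall>i<length vs. 0 \<le> u \<bullet> (vs ! i))"
proof -
  have dim: "dim_vec (vs ! i) = l" if "i < length vs" for i
    using vs nth_mem[OF that] by auto
  have pairing: "u \<bullet> vec l (\<lambda>j. \<Sum>i<length vs. c i * (vs ! i) $ j) =
      (\<Sum>i<length vs. c i * (u \<bullet> (vs ! i)))" for c
  proof -
    have "u \<bullet> vec l (\<lambda>j. \<Sum>i<length vs. c i * (vs ! i) $ j) =
        (\<Sum>j<l. \<Sum>i<length vs. u $ j * (c i * (vs ! i) $ j))"
      by (simp add: scalar_prod_def sum_distrib_left lessThan_atLeast0)
    also have "\<dots> = (\<Sum>i<length vs. \<Sum>j<l. u $ j * (c i * (vs ! i) $ j))"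
      by (rule sum.swap)
    also have "\<dots> = (\<Sum>i<length vs. c i * (u \<bullet> (vs ! i)))"
      by (intro sum.cong refl)
        (simp add: scalar_prod_def dim sum_distrib_left lessThan_atLeast0 algebra_simps)
    finally show ?thesis .
  qed
  show ?thesis
  proof
    assume u: "u \<in> dual_cone l (cone_generated l vs)"
    have "0 \<le> u \<bullet> (vs ! i)" if "i < length vs" for i
    proof -
      define c :: "nat \<Rightarrow> real" where "c = (\<lambda>k. if k = i then 1 else 0)"
      have "vec l (\<lambda>j. \<Sum>k<length vs. c k * (vs ! k) $ j) \<in> cone_generated l vs"
        unfolding cone_generated_def by (rule CollectI, rule exI[of _ c]) (simp add: c_def)
      then have "0 \<le> (\<Sum>k<length vs. c k * (u \<bullet> (vs ! k)))"
        using u unfolding dual_cone_def pairing[symmetric] by blast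
      then show ?thesis
        using that by (simp add: c_def if_distrib[where f = "\<lambda>x. x * _"] cong: if_cong)
    qed
    then show "u \<in> carrier_vec l \<and> (\<forall>i<length vs. 0 \<le> u \<bullet> (vs ! i))"
      using u by (simp add: dual_cone_def)
  next
    assume "u \<in> carrier_vec l \<and> (\<forall>i<length vs. 0 \<le> u \<bullet> (vs ! i))"
    then show "u \<in> dual_cone l (cone_generated l vs)"
      by (auto simp: dual_cone_def cone_generated_def pairing intro!: sum_nonneg)
  qed
qed

text \<open>The integral points of the dual cone correspond to the exponents allowed in the ring: both
  conditions say that the same integers are nonnegative.\<close>

lemma mem_dual_cone_rows:
  fixes K :: "int mat"
  assumes K: "K \<in> carrier_mat n l" and "r \<le> n" and c: "c \<in> carrier_vec l"
  shows "map_vec real_of_int c \<in>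
      dual_cone l (cone_generated l (map (\<lambda>i. map_vec real_of_int (row K i)) [0..<r])) \<longleftrightarrow>
    (\<forall>i<r. 0 \<le> (K *\<^sub>v c) $ i)"
proof -
  have "map_vec real_of_int c \<bullet> map_vec real_of_int (row K i) = real_of_int ((K *\<^sub>v c) $ i)"
    if "i < r" for i
    using that assms by (simp add: scalar_prod_def mult.commute)
  moreover have "set (map (\<lambda>i. map_vec real_of_int (row K i)) [0..<r]) \<subseteq> carrier_vec l"
    using K by auto
  ultimately show ?thesis
    using c by (simp add: mem_dual_cone_generated)
qed

lemma nat_combination_mem_submonoid:
  fixes P :: "int vec set"
  assumes P: "P \<subseteq> carrier_vec l" and zero: "0\<^sub>v l \<in> P"
    and add: "\<And>u v. u \<in> P \<Longrightarrow> v \<in> P \<Longrightarrow> u + v \<in> P"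
    and "finite W" "W \<subseteq> P"
  shows "vec l (\<lambda>j. \<Sum>w\<in>W. int (c w) * w $ j) \<in> P"
  using \<open>finite W\<close> \<open>W \<subseteq> P\<close>
proof (induction W rule: finite_induct)
  case empty
  then show ?case using zero by (simp add: zero_vec_def)
next
  case (insert w W)
  have w: "w \<in> P" "dim_vec w = l" using insert.prems P by auto
  have multiple: "int k \<cdot>\<^sub>v w \<in> P" for k
  proof (induction k)
    case 0
    have "int 0 \<cdot>\<^sub>v w = 0\<^sub>v l" using w(2) by auto
    then show ?case using zero by simp
  next
    case (Suc k)
    have "int (Suc k) \<cdot>\<^sub>v w = int k \<cdot>\<^sub>v w + w" using w(2) by (auto simp: algebra_simps)
    then show ?case using add Suc w(1) by simp
  qed
  have "vec l (\<lambda>j. \<Sum>v\<in>insert w W. int (c v) * v $ j) =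
      int (c w) \<cdot>\<^sub>v w + vec l (\<lambda>j. \<Sum>v\<in>W. int (c v) * v $ j)"
    using insert.hyps w(2) by auto
  then show ?case using add multiple insert by simp
qed

section \<open>Generators of the algebra of degree zero\<close>

theorem proposition8p5:
  fixes r s n p t m l :: nat
    and d :: "nat \<Rightarrow> nat"
    and F :: "nat \<Rightarrow> 'g monoid"
    and \<iota> :: "nat \<Rightarrow> int \<Rightarrow> 'g \<Rightarrow> 'k::{alg_closed_field, field_char_0}"
    and \<eta> :: "nat \<Rightarrow> (nat \<Rightarrow> int) \<times> (nat \<Rightarrow> int)"
    and L K :: "int mat"
    and W :: "int vec set"
  assumes "n = r + s" and "m = p + t" and "l = n - p"
    and "\<And>j. j < t \<Longrightarrow> 0 < d j"
    and "\<And>j. j < t \<Longrightarrow> group (F j) \<and> cyclic_group (F j) \<and> order (F j) = d j"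
    and "\<And>j. j < t \<Longrightarrow> \<iota> j \<in> iso (integer_mod_group (d j)) (character_group (F j))"
    and "\<And>i. i < n \<Longrightarrow> \<eta> i \<in> carrier (weight_group p t d)"
    and "faithful_action (diag_group p t F) (affine_torus_space r n)
           (diag_action r n (\<lambda>h i. character_of p t \<iota> (\<eta> i) h))"
    and "L \<in> carrier_mat m n"
    and "\<And>i. i < n \<Longrightarrow> weight_class p t d (col L i) = \<eta> i"
    and "K \<in> carrier_mat n l"
    and "columns_form_int_basis K (degree_kernel n p t d L)"
    and "infinite_dimensional (degree_zero_part r n p t d L :: 'k laurent set)"
    and "is_hilbert_basis l
           (dual_cone l (cone_generated l (map (\<lambda>i. map_vec real_of_int (row K i)) [0..<r]))) W"
  shows "(degree_zero_part r n p t d L :: 'k laurent set) =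
           generated_subalgebra ((\<lambda>w. laurent_monom (K *\<^sub>v w)) ` W)"
proof (rule equalityI)
  let ?M = "{laurent_monom a :: 'k laurent | a.
      (laurent_monom a :: 'k laurent) \<in> laurent_ring r n \<and> a \<in> degree_kernel n p t d L}"
  let ?B = "generated_subalgebra ((\<lambda>w. laurent_monom (K *\<^sub>v w)) ` W) :: 'k laurent set"
  let ?C = "dual_cone l (cone_generated l (map (\<lambda>i. map_vec real_of_int (row K i)) [0..<r]))"
  have rn: "r \<le> n" using \<open>n = r + s\<close> by simp
  have L: "L \<in> carrier_mat (p + t) n" using \<open>L \<in> carrier_mat m n\<close> \<open>m = p + t\<close> by simp
  note K = \<open>K \<in> carrier_mat n l\<close>
  have dim_K: "dim_col K = l" using K by simp
  have cols: "set (cols K) \<subseteq> degree_kernel n p t d L"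
    and basis: "\<And>a. a \<in> degree_kernel n p t d L \<Longrightarrow> \<exists>c\<in>carrier_vec l. a = K *\<^sub>v c"
    using \<open>columns_form_int_basis K _\<close> unfolding columns_form_int_basis_def dim_K by blast+
  have W: "finite W" "W \<subseteq> carrier_vec l" "map_vec real_of_int ` W \<subseteq> ?C"
    and hilbert: "\<And>u. u \<in> carrier_vec l \<Longrightarrow> map_vec real_of_int u \<in> ?C \<Longrightarrow>
      \<exists>c :: int vec \<Rightarrow> nat. u = vec l (\<lambda>j. \<Sum>w\<in>W. int (c w) * w $ j)"
    using \<open>is_hilbert_basis l ?C W\<close> unfolding is_hilbert_basis_def by blast+
  have carrier: "a \<in> carrier_vec n" if "a \<in> degree_kernel n p t d L" for a
    using that by (simp add: mem_degree_kernel)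
  have M_iff: "laurent_monom a \<in> ?M" if "a \<in> degree_kernel n p t d L" "\<forall>i<r. 0 \<le> a $ i" for a
    using that laurent_monom_mem_laurent_ring[OF carrier rn] by blast

  have B: "laurent.subspace ?B" "1 \<in> ?B" "\<And>f g. f \<in> ?B \<Longrightarrow> g \<in> ?B \<Longrightarrow> f * g \<in> ?B"
    using is_subalgebra_generated unfolding is_subalgebra_def by blast+
  \<comment> \<open>The exponents of monomials in a subalgebra form a monoid, here pulled back along \<open>K\<close>.\<close>
  have combination: "vec l (\<lambda>j. \<Sum>w\<in>W. int (c w) * w $ j) \<in>
      {u \<in> carrier_vec l. laurent_monom (K *\<^sub>v u) \<in> ?B}" for c
  proof (rule nat_combination_mem_submonoid[OF _ _ _ \<open>finite W\<close>])
    have "K *\<^sub>v 0\<^sub>v l = 0\<^sub>v n" using K by auto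
    then show "0\<^sub>v l \<in> {u \<in> carrier_vec l. laurent_monom (K *\<^sub>v u) \<in> ?B}"
      using B(2) by (simp add: laurent_monom_zero)
    show "u + v \<in> {u \<in> carrier_vec l. laurent_monom (K *\<^sub>v u) \<in> ?B}"
      if "u \<in> {u \<in> carrier_vec l. laurent_monom (K *\<^sub>v u) \<in> ?B}"
        "v \<in> {u \<in> carrier_vec l. laurent_monom (K *\<^sub>v u) \<in> ?B}" for u v
    proof -
      have "laurent_monom (K *\<^sub>v (u + v)) =
          (laurent_monom (K *\<^sub>v u) * laurent_monom (K *\<^sub>v v) :: 'k laurent)"
        using that K by (simp add: mult_add_distrib_mat_vec laurent_monom_add[where n = n])
      then show ?thesis using that B(3) by simp
    qed
    show "W \<subseteq> {u \<in> carrier_vec l. laurent_monom (K *\<^sub>v u) \<in> ?B}"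
      using W(2) generated_subalgebra_superset by fastforce
  qed simp
  have "?M \<subseteq> ?B"
  proof
    fix f assume "f \<in> ?M"
    then obtain a where a: "f = laurent_monom a" "laurent_monom a \<in> (laurent_ring r n :: 'k laurent set)"
      "a \<in> degree_kernel n p t d L" by blast
    obtain c where c: "c \<in> carrier_vec l" "a = K *\<^sub>v c" using basis a(3) by blast
    have "map_vec real_of_int c \<in> ?C"
      using a(2) laurent_monom_mem_laurent_ring[OF carrier[OF a(3)] rn, where 'k = 'k]
        mem_dual_cone_rows[OF K rn c(1)] c(2) by simp
    then show "f \<in> ?B"
      using hilbert[OF c(1)] combination a(1) c(2) by auto
  qed
  then show "degree_zero_part r n p t d L \<subseteq> ?B"
    unfolding degree_zero_part_def by (rule laurent.span_minimal) (rule B(1))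

  have "laurent_monom (K *\<^sub>v w) \<in> ?M" if "w \<in> W" for w
  proof (rule M_iff)
    have w: "w \<in> carrier_vec l" using W(2) that by blast
    show "K *\<^sub>v w \<in> degree_kernel n p t d L"
      by (rule mult_mat_vec_mem_degree_kernel[OF L K cols w])
    show "\<forall>i<r. 0 \<le> (K *\<^sub>v w) $ i"
      using W(3) that mem_dual_cone_rows[OF K rn w] by blast
  qed
  then have generators: "(\<lambda>w. laurent_monom (K *\<^sub>v w)) ` W \<subseteq> laurent.span ?M"
    using laurent.span_superset[of ?M] by blast
  have "1 \<in> ?M"
    using M_iff[OF zero_mem_degree_kernel[OF L]] rn by (simp add: laurent_monom_zero)
  moreover have "f * g \<in> ?M" if "f \<in> ?M" "g \<in> ?M" for f g
  proof -
    obtain a where a: "f = laurent_monom a" "laurent_monom a \<in> (laurent_ring r n :: 'k laurent set)"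
      "a \<in> degree_kernel n p t d L" using \<open>f \<in> ?M\<close> by blast
    obtain b where b: "g = laurent_monom b" "laurent_monom b \<in> (laurent_ring r n :: 'k laurent set)"
      "b \<in> degree_kernel n p t d L" using \<open>g \<in> ?M\<close> by blast
    have "\<forall>i<r. 0 \<le> (a + b) $ i"
      using a(2) b(2) carrier[OF a(3)] carrier[OF b(3)] rn
      by (simp add: laurent_monom_mem_laurent_ring[where n = n])
    then have "laurent_monom (a + b) \<in> ?M"
      using M_iff add_mem_degree_kernel[OF L a(3) b(3)] by blast
    then show ?thesis
      using a b carrier laurent_monom_add[of a n b, where 'a = 'k] by simp
  qed
  ultimately have "is_subalgebra (laurent.span ?M)" by (rule is_subalgebra_span)
  then show "?B \<subseteq> degree_zero_part r n p t d L"
    unfolding degree_zero_part_def by (rule generated_subalgebra_least[OF generators])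
qed

end
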